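(* Let $\langle G,0,+,-,\le\rangle$ be an ordered topological group, and let $T_1,T_2,\dots$ be subsets of the positive cone of $G$ that are locally cofinite at $0$. Let $n\ge 1$ and $E_n = T_1+\cdots+T_n=\{a_1+\cdots+a_n : a_i\in T_i\}$. Then the number of representations of any element of $E_n$ is finite.
   Context: A topological group $\langle G,0,+,-\rangle$ is a group, written additively but not assumed abelian, equipped with a Hausdorff topology for which addition and additive inverse are continuous. An ordered topological group is a topological group together with a partial order $\le$ on $G$ such that $a\le b$ and $c\le d$ imply $a+c\le b+d$; no compatibility between the order and the topology is assumed, and the order need not be linear. Write $a<b$ if $a\le b$ and $a\ne b$. The positive cone of $G$ is $\{g\in G : 0<g\}$. A subset $T\subseteq G$ is called locally cofinite at $0$ if (1) $0\notin T$, and (2) for every open neighborhood $u$ of $0$, the set $T\setminus u$ is finite. A representation of $g\in E_n$ is a tuple $\langle g_1,\dots,g_n\rangle\in T_1\times\cdots\times T_n$ such that $g=g_1+\cdots+g_n$. *)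

theory Defs
  imports Complex_Main
begin

text \<open>
  The library class \<^class>\<open>topological_group_add\<close> assumes neither commutativity nor
  the Hausdorff property, hence \<^class>\<open>t2_space\<close>. No axiom links the order to the topology.
\<close>

class ordered_topological_group = topological_group_add + t2_space + order +
  assumes add_mono_both: "a \<le> b \<Longrightarrow> c \<le> d \<Longrightarrow> a + c \<le> b + d"

definition positive_cone :: "'a::ordered_topological_group set" where
  "positive_cone = {g. 0 < g}"

definition locally_cofinite_at_0 :: "'a::ordered_topological_group set \<Rightarrow> bool" where
  "locally_cofinite_at_0 S \<longleftrightarrow> 0 \<notin> S \<and> (\<forall>u. open u \<and> 0 \<in> u \<longrightarrow> finite (S - u))"

text \<open>
  Tuples in \<open>T\<^sub>1 \<times> \<dots> \<times> T\<^sub>n\<close> are lists of length \<open>n\<close>. The family is indexed from 1, so \<open>T 0\<close> is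
  never used; \<^const>\<open>sum_list\<close> keeps the order of the summands, as the group need not be abelian.
\<close>

definition tuples :: "(nat \<Rightarrow> 'a set) \<Rightarrow> nat \<Rightarrow> 'a list set" where
  "tuples T n = listset (map T [1..<Suc n])"

definition sumset :: "(nat \<Rightarrow> 'a::ordered_topological_group set) \<Rightarrow> nat \<Rightarrow> 'a set" where
  "sumset T n = {sum_list as | as. as \<in> tuples T n}"

definition representations ::
    "(nat \<Rightarrow> 'a::ordered_topological_group set) \<Rightarrow> nat \<Rightarrow> 'a \<Rightarrow> 'a list set" where
  "representations T n g = {gs \<in> tuples T n. g = sum_list gs}"

end

(* Given infinitely many representations of g, enumerate them injectively.  In a set that is locally
   cofinite at 0, every sequence has a subsequence that is either constant or converges to 0, and in
   the second case it lies strictly above its limit.  Refining coordinate by coordinate, the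
   sums along a subsequence converge to some l; unless all coordinates are constant on it, which
   injectivity excludes, every sum is strictly above l.  But all the sums equal g, so l = g. *)

theory Submission
  imports Defs "HOL-Library.Infinite_Set"
begin

text \<open>Strictness survives addition because cancellation in the group keeps
  \<open>a + c\<close> and \<open>b + c\<close> distinct.\<close>

lemma add_less_le_both:
  fixes a b c d :: "'a::ordered_topological_group"
  assumes "a < b" "c \<le> d"
  shows "a + c < b + d"
proof -
  have "a + c \<le> b + c" "b + c \<le> b + d"
    using assms by (auto intro: add_mono_both)
  moreover have "a + c \<noteq> b + c"
    using assms by simp
  ultimately show ?thesis
    by order
qed

text \<open>Without commutativity, strictness in the right summand needs its own argument, by
  cancellation on the left.\<close>

lemma add_le_less_both:
  fixes a b c d :: "'a::ordered_topological_group"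
  assumes "a \<le> b" "c < d"
  shows "a + c < b + d"
proof -
  have "a + c \<le> b + c" "b + c \<le> b + d"
    using assms by (auto intro: add_mono_both)
  moreover have "b + c \<noteq> b + d"
    using assms by simp
  ultimately show ?thesis
    by order
qed

text \<open>A value taken infinitely often gives a constant subsequence. Otherwise only finitely
  many values lie outside a given neighborhood of 0, each taken finitely often, so the whole
  sequence already tends to 0.\<close>

lemma locally_cofinite_subseq:
  fixes s :: "nat \<Rightarrow> 'a::ordered_topological_group"
  assumes cof: "locally_cofinite_at_0 S" and mem: "\<And>k. s k \<in> S"
  obtains r where "strict_mono r" "(\<exists>v. \<forall>k. s (r k) = v) \<or> (\<lambda>k. s (r k)) \<longlonglongrightarrow> 0"
proof (cases "\<exists>v. infinite {k. s k = v}")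
  case True
  then obtain v where "infinite {k. s k = v}"
    by blast
  then obtain r :: "nat \<Rightarrow> nat" where "strict_mono r" "\<forall>k. r k \<in> {k. s k = v}"
    using infinite_enumerate by blast
  then show thesis
    using that by blast
next
  case False
  have "s \<longlonglongrightarrow> 0"
  proof (rule topological_tendstoI)
    fix u :: "'a set"
    assume "open u" "0 \<in> u"
    then have "finite (S - u)"
      using cof by (simp add: locally_cofinite_at_0_def)
    then have "finite (\<Union>v\<in>S - u. {k. s k = v})"
      using False by blast
    moreover have "{k. s k \<notin> u} \<subseteq> (\<Union>v\<in>S - u. {k. s k = v})"
      using mem by blast
    ultimately have "finite {k. s k \<notin> u}"
      by (rule rev_finite_subset)
    then show "\<forall>\<^sub>F k in sequentially. s k \<in> u"
      by (simp add: cofinite_eq_sequentially [symmetric] eventually_cofinite)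
  qed
  then show thesis
    using that [of id] by (simp add: strict_mono_def)
qed

text \<open>Induction on the number of coordinates. The first alternative fixes the list and not
  merely its sum, since it has to clash with injectivity later.\<close>

lemma listset_subseq:
  fixes X :: "nat \<Rightarrow> 'a::ordered_topological_group list"
  assumes "\<And>S. S \<in> set Ts \<Longrightarrow> S \<subseteq> positive_cone \<and> locally_cofinite_at_0 S"
    and "\<And>k. X k \<in> listset Ts"
  shows "\<exists>r l. strict_mono r \<and> (\<lambda>k. sum_list (X (r k))) \<longlonglongrightarrow> l \<and>
    ((\<exists>xs. sum_list xs = l \<and> (\<forall>k. X (r k) = xs)) \<or> (\<forall>k. l < sum_list (X (r k))))"
  using assms
proof (induction Ts arbitrary: X)
  case Nil
  then have "X = (\<lambda>_. [])"
    by auto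
  then show ?case
    by (intro exI [of _ id] exI [of _ 0]) (simp add: strict_mono_def)
next
  case (Cons S Ts)
  define a where "a k = hd (X k)" for k
  define b where "b k = tl (X k)" for k
  have X: "X k = a k # b k" and a: "a k \<in> S" and b: "b k \<in> listset Ts" for k
    using Cons.prems(2) [of k] by (auto simp: a_def b_def set_Cons_def)
  \<comment> \<open>The tails are refined first, then the heads along \<open>r1\<close>; both
    alternatives in \<open>alt1\<close> hold for all \<open>k\<close>, so they persist under
    \<open>r2\<close>.\<close>
  obtain r1 l1 where r1: "strict_mono r1" and lim1: "(\<lambda>k. sum_list (b (r1 k))) \<longlonglongrightarrow> l1"
    and alt1: "(\<exists>xs. sum_list xs = l1 \<and> (\<forall>k. b (r1 k) = xs)) \<or> (\<forall>k. l1 < sum_list (b (r1 k)))"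
    using Cons.IH [of b] Cons.prems(1) b by auto
  obtain r2 where r2: "strict_mono r2"
    and "(\<exists>v. \<forall>k. a (r1 (r2 k)) = v) \<or> (\<lambda>k. a (r1 (r2 k))) \<longlonglongrightarrow> 0"
    using locally_cofinite_subseq [of S "\<lambda>k. a (r1 k)"] Cons.prems(1) a by auto
  moreover have "0 < a k" for k
    using Cons.prems(1) a by (fastforce simp: positive_cone_def)
  \<comment> \<open>The limit is either the constant value, read off at index 0, or 0, which
    positivity keeps strictly below every head.\<close>
  ultimately have "\<exists>l2. (\<lambda>k. a (r1 (r2 k))) \<longlonglongrightarrow> l2 \<and>
    ((\<forall>k. a (r1 (r2 k)) = l2) \<or> (\<forall>k. l2 < a (r1 (r2 k))))"
    by (auto intro: exI [of _ 0] exI [of _ "a (r1 (r2 0))"])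
  then obtain l2 where lim2: "(\<lambda>k. a (r1 (r2 k))) \<longlonglongrightarrow> l2"
    and alt2: "(\<forall>k. a (r1 (r2 k)) = l2) \<or> (\<forall>k. l2 < a (r1 (r2 k)))"
    by blast
  define r where "r = r1 \<circ> r2"
  have "strict_mono r"
    using r1 r2 by (simp add: r_def strict_mono_o)
  moreover have "(\<lambda>k. sum_list (X (r k))) \<longlonglongrightarrow> l2 + l1"
    using tendsto_add [OF lim2 LIMSEQ_subseq_LIMSEQ [OF lim1 r2]] by (simp add: X r_def o_def)
  moreover have "(\<exists>xs. sum_list xs = l2 + l1 \<and> (\<forall>k. X (r k) = xs)) \<or>
    (\<forall>k. l2 + l1 < sum_list (X (r k)))"
  \<comment> \<open>One strict summand makes the sum strict: if the heads are strict, a weak bound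
    on the tails suffices; if the heads are constant, the tails decide.\<close>
  proof (cases "\<forall>k. l2 < a (r1 (r2 k))")
    case True
    moreover have "l1 \<le> sum_list (b (r1 k))" for k
      using alt1 by (auto intro: less_imp_le)
    ultimately show ?thesis
      by (simp add: X r_def add_less_le_both)
  next
    case False
    then have const: "a (r1 (r2 k)) = l2" for k
      using alt2 by blast
    from alt1 show ?thesis
    proof
      assume "\<exists>xs. sum_list xs = l1 \<and> (\<forall>k. b (r1 k) = xs)"
      then obtain xs where "sum_list xs = l1" "\<forall>k. b (r1 k) = xs"
        by blast
      then have "sum_list (l2 # xs) = l2 + l1 \<and> (\<forall>k. X (r k) = l2 # xs)"
        by (simp add: X r_def const)
      then show ?thesis
        by blast
    qed (simp add: X r_def const add_le_less_both)
  qed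
  ultimately show ?case
    by blast
qed

theorem theorem2p4:
  fixes T :: "nat \<Rightarrow> 'a::ordered_topological_group set" and n :: nat
  assumes "\<And>i. i \<ge> 1 \<Longrightarrow> T i \<subseteq> positive_cone"
    and "\<And>i. i \<ge> 1 \<Longrightarrow> locally_cofinite_at_0 (T i)"
    and "n \<ge> 1"
  shows "\<forall>g \<in> sumset T n. finite (representations T n g)"
proof (intro ballI, rule ccontr)
  fix g
  assume "infinite (representations T n g)"
  then obtain X :: "nat \<Rightarrow> 'a list" where X: "inj X" "range X \<subseteq> representations T n g"
    using infinite_countable_subset by blast
  then have "X k \<in> representations T n g" for k
    by blast
  then have mem: "X k \<in> listset (map T [1..<Suc n])" and sum: "sum_list (X k) = g" for k
    by (simp_all add: representations_def tuples_def del: upt_Suc)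
  have T: "S \<subseteq> positive_cone \<and> locally_cofinite_at_0 S" if S: "S \<in> set (map T [1..<Suc n])" for S
  proof -
    obtain i where "S = T i" "i \<ge> 1"
      using S by (auto simp del: upt_Suc)
    then show ?thesis
      using assms(1,2) by blast
  qed
  obtain r l where r: "strict_mono r"
    and lim: "(\<lambda>k. sum_list (X (r k))) \<longlonglongrightarrow> l"
    and alt: "(\<exists>xs. sum_list xs = l \<and> (\<forall>k. X (r k) = xs)) \<or> (\<forall>k. l < sum_list (X (r k)))"
    using listset_subseq [where X = X, OF T mem] by blast
  \<comment> \<open>The sums are constantly \<open>g\<close>, and limits are unique in a Hausdorff
    space.\<close>
  have "l = g"
    using lim by (simp add: sum LIMSEQ_const_iff)
  \<comment> \<open>The strict alternative would now say \<open>g < g\<close>, so the lists along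
    \<open>r\<close> are all equal.\<close>
  then have "X (r 0) = X (r 1)"
    using alt by (auto simp: sum)
  then have "r 0 = r 1"
    using X(1) by (simp add: inj_eq)
  then show False
    using strict_monoD [OF r, of 0 1] by simp
qed

end
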